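(* Let $\mathcal{V}$ be an $\alpha$-valuation of the complete bipartite graph $K_{a,b}$ with $ab>1$. Then there exists an integer $\ell\geq 2$ such that $\mathcal{V}$ is equivalent to an $\alpha$-valuation $(V^{\sf small},V^{\sf large})$ with the following properties: (1) every element of $V^{\sf large}$ is a multiple of $\ell$; (2) the set $V^{\sf small}$ is a union of runs of $\ell$ consecutive integers, each run starting with a multiple of $\ell$ (i.e., of sets $\{i\ell,i\ell+1,\dots,i\ell+\ell-1\}$).
   Context: For a graph $G$ with $n$ edges, an $\alpha$-valuation is a one-to-one map from the vertices into $\{0,1,\dots,n\}$ such that the absolute differences of the labels of the endpoints of the edges are exactly $\{1,\dots,n\}$, and there is a value $x$ with $0\le x\le n$ such that every edge joins a vertex with label $\le x$ to one with label $>x$. Vertices are identified with labels; $V^{\sf small}$ is the set of labels $\le x$ and $V^{\sf large}$ the set of labels $>x$. For $K_{a,b}$ the labels lie in $\{0,\dots,ab\}$. Define $\Phi_{ab}(z)=ab-z$ on $\{0,\dots,ab\}$. Two $\alpha$-valuations $\mathcal{V}_1,\mathcal{V}_2$ of $K_{a,b}$ are equivalent if $\mathcal{V}_1=\mathcal{V}_2$, or if for every vertex of $K_{a,b}$ its label in $\mathcal{V}_2$ is obtained by applying $\Phi_{ab}$ to its label in $\mathcal{V}_1$ (in which case $\Phi_{ab}$ maps the $V^{\sf small}$ labels of $\mathcal{V}_1$ to the $V^{\sf large}$ labels of $\mathcal{V}_2$ and vice versa). *)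

theory Defs
  imports Main
begin

text \<open>A finite simple graph is a pair of a vertex set and a set of two-element edges.\<close>

type_synonym 'v ugraph = "'v set \<times> 'v set set"

abbreviation verts :: "'v ugraph \<Rightarrow> 'v set" where "verts \<equiv> fst"
abbreviation edges :: "'v ugraph \<Rightarrow> 'v set set" where "edges \<equiv> snd"

definition complete_bipartite :: "nat \<Rightarrow> nat \<Rightarrow> (nat + nat) ugraph" where
  "complete_bipartite a b =
     ({..<a} <+> {..<b}, {{Inl i, Inr j} | i j. i < a \<and> j < b})"

definition separates :: "'v ugraph \<Rightarrow> ('v \<Rightarrow> int) \<Rightarrow> int \<Rightarrow> bool" where
  "separates G f x \<longleftrightarrow> 0 \<le> x \<and> x \<le> int (card (edges G)) \<and>
     (\<forall>e\<in>edges G. \<exists>u v. e = {u, v} \<and> f u \<le> x \<and> x < f v)"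

definition alpha_valuation :: "'v ugraph \<Rightarrow> ('v \<Rightarrow> int) \<Rightarrow> bool" where
  "alpha_valuation G f \<longleftrightarrow>
     inj_on f (verts G) \<and>
     f ` verts G \<subseteq> {0..int (card (edges G))} \<and>
     {\<bar>f u - f v\<bar> | u v. {u, v} \<in> edges G} = {1..int (card (edges G))} \<and>
     (\<exists>x. separates G f x)"

definition small_labels :: "'v ugraph \<Rightarrow> ('v \<Rightarrow> int) \<Rightarrow> int \<Rightarrow> int set" where
  "small_labels G f x = {z \<in> f ` verts G. z \<le> x}"

definition large_labels :: "'v ugraph \<Rightarrow> ('v \<Rightarrow> int) \<Rightarrow> int \<Rightarrow> int set" where
  "large_labels G f x = {z \<in> f ` verts G. x < z}"

definition Phi :: "nat \<Rightarrow> nat \<Rightarrow> int \<Rightarrow> int" where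
  "Phi a b z = int (a * b) - z"

text \<open>Valuations only matter on the vertex set, so their equality is equality there.\<close>

definition valuation_equiv :: "nat \<Rightarrow> nat \<Rightarrow> (nat + nat \<Rightarrow> int) \<Rightarrow> (nat + nat \<Rightarrow> int) \<Rightarrow> bool" where
  "valuation_equiv a b f g \<longleftrightarrow>
     (\<forall>v\<in>verts (complete_bipartite a b). g v = f v) \<or>
     (\<forall>v\<in>verts (complete_bipartite a b). g v = Phi a b (f v))"

lemma card_edges_complete_bipartite: "card (edges (complete_bipartite a b)) = a * b"
proof -
  have "edges (complete_bipartite a b) = (\<lambda>(i, j). {Inl i, Inr j}) ` ({..<a} \<times> {..<b})"
    by (auto simp: complete_bipartite_def)
  moreover have "inj_on (\<lambda>(i, j). {Inl i, Inr j}) ({..<a} \<times> {..<b})"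
    by (auto simp: inj_on_def doubleton_eq_iff)
  ultimately show ?thesis
    by (simp add: card_image card_cartesian_product)
qed

text \<open>
  The edge with label 1 determines the separating value, so the small and large labels
  are determined by the valuation.
\<close>

lemma separates_unique:
  assumes f: "alpha_valuation G f" and n: "0 < card (edges G)"
    and x: "separates G f x" and y: "separates G f y"
  shows "x = y"
proof -
  have "1 \<in> {\<bar>f u - f v\<bar> | u v. {u, v} \<in> edges G}"
    using f n by (auto simp: alpha_valuation_def)
  then obtain u v where e: "{u, v} \<in> edges G" and d: "\<bar>f u - f v\<bar> = 1"
    by auto
  have sep: "z = min (f u) (f v)" if z: "separates G f z" for z
  proof -
    obtain u' v' where "{u, v} = {u', v'}" "f u' \<le> z" "z < f v'"
      using z e by (fastforce simp: separates_def)
    then show ?thesis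
      using d by (auto simp: doubleton_eq_iff)
  qed
  show ?thesis
    using sep[OF x] sep[OF y] by simp
qed

end

theory Submission imports Defs begin

text \<open>
  Let \<open>x\<close> be the separating value. Then \<open>A = x - V_small\<close> and \<open>B = V_large - (x + 1)\<close> form a
  factorization \<open>A \<oplus> B = {0..<n}\<close> with unique representations, and \<open>\<Phi>\<close> swaps \<open>A\<close> and \<open>B\<close>,
  so we may assume \<open>1 \<in> A\<close>. Take for \<open>l\<close> the least positive element of \<open>B\<close> (or \<open>n\<close> if there is
  none). By induction on \<open>k\<close>, the block \<open>{k * l..<k * l + l}\<close> is either contained in \<open>A\<close> or
  disjoint from it, and meets \<open>B\<close> at most in \<open>k * l\<close>: the sums of elements from earlier blocks
  cover the block \<open>k\<close> either completely or not at all.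
\<close>

section \<open>Factorizations of an integer interval into a sum of two sets\<close>

locale interval_factorization =
  fixes A B :: "int set" and n :: int
  assumes A_nonneg: "p \<in> A \<Longrightarrow> 0 \<le> p"
    and B_nonneg: "q \<in> B \<Longrightarrow> 0 \<le> q"
    and unique: "\<lbrakk>p \<in> A; q \<in> B; p' \<in> A; q' \<in> B; p + q = p' + q'\<rbrakk> \<Longrightarrow> p = p' \<and> q = q'"
    and sum_less: "\<lbrakk>p \<in> A; q \<in> B\<rbrakk> \<Longrightarrow> p + q < n"
    and represent: "\<lbrakk>0 \<le> z; z < n\<rbrakk> \<Longrightarrow> \<exists>p\<in>A. \<exists>q\<in>B. z = p + q"
    and one_in_A: "1 \<in> A"
    and zero_in_A: "0 \<in> A"
    and zero_in_B: "0 \<in> B"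
begin

lemma blocks:
  assumes l: "l \<in> B" "0 < l" and least: "\<And>q. \<lbrakk>q \<in> B; 0 < q\<rbrakk> \<Longrightarrow> l \<le> q"
    and "0 \<le> k"
  shows "(\<forall>r r'. 0 \<le> r \<and> r < l \<and> 0 \<le> r' \<and> r' < l \<and> k * l + r \<in> A \<longrightarrow> k * l + r' \<in> A) \<and>
         (\<forall>r. 0 \<le> r \<and> r < l \<and> k * l + r \<in> B \<longrightarrow> r = 0)"
  using \<open>0 \<le> k\<close>
proof (induction "nat k" arbitrary: k rule: less_induct)
  case less
  have l_less: "l < n" using sum_less[OF zero_in_A l(1)] by simp
  have q0: "q = 0" if "q \<in> B" "q < l" for q
    using least[OF that(1)] B_nonneg[OF that(1)] that(2) by linarith
  \<comment> \<open>The only element of \<open>B\<close> below \<open>l\<close> is 0, so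
    \<open>r\<close> can only be represented as \<open>r + 0\<close>.\<close>
  have init: "r \<in> A" if r: "0 \<le> r" "r < l" for r
  proof -
    obtain p q where pq: "p \<in> A" "q \<in> B" "r = p + q"
      using represent[of r] r l_less by auto
    then have "q = 0" using q0[of q] A_nonneg[of p] r by linarith
    then show ?thesis using pq by simp
  qed
  show ?case
  proof (cases "k = 0")
    case True
    then show ?thesis using init q0 by auto
  next
    case False
    with less.prems have k1: "1 \<le> k" by simp
    then have kl: "l \<le> k * l" using l(2) by simp
    have IH_A: "i * l + r' \<in> A"
      if "0 \<le> i" "i < k" "i * l + r \<in> A" "0 \<le> r" "r < l" "0 \<le> r'" "r' < l" for i r r'
      using less.hyps[of i] that by auto
    have IH_B: "r = 0" if "0 \<le> i" "i < k" "i * l + r \<in> B" "0 \<le> r" "r < l" for i r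
      using less.hyps[of i] that by auto
    \<comment> \<open>The all-or-nothing alternative: either a full block \<open>i\<close> of
      \<open>A\<close>, shifted by some \<open>j * l\<close> in \<open>B\<close>, lands on block
      \<open>k\<close> with both indices below \<open>k\<close>, or no sum of two elements below
      \<open>k * l\<close> reaches block \<open>k\<close>.\<close>
    show ?thesis
    proof (cases "\<exists>i j. 0 \<le> i \<and> i < k \<and> 0 \<le> j \<and> j < k \<and> i + j = k \<and>
        (\<forall>r. 0 \<le> r \<and> r < l \<longrightarrow> i * l + r \<in> A) \<and> j * l \<in> B")
      case True
      then obtain i j where ij: "0 \<le> i" "i < k" "0 \<le> j" "j < k" "i + j = k"
        and iA: "\<And>r. 0 \<le> r \<Longrightarrow> r < l \<Longrightarrow> i * l + r \<in> A" and jB: "j * l \<in> B" by blast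
      have kl_eq: "k * l = i * l + j * l" using ij by (metis distrib_right)
      \<comment> \<open>Both indices are below their sum \<open>k\<close>, hence positive. So
        \<open>(i * l + r) + j * l\<close> differs from the representations of
        \<open>k * l + r\<close> that have a summand 0, and uniqueness keeps both \<open>A\<close>
        and \<open>B\<close> out of the block.\<close>
      have pos: "0 < i * l" "0 < j * l" using ij l(2) by auto
      have "k * l + r \<notin> A" if r: "0 \<le> r" "r < l" for r
      proof
        assume "k * l + r \<in> A"
        from unique[OF this zero_in_B iA[OF r] jB] show False using kl_eq pos by linarith
      qed
      moreover have "k * l + r \<notin> B" if r: "0 \<le> r" "r < l" for r
      proof
        assume "k * l + r \<in> B"
        from unique[OF zero_in_A this iA[OF r] jB] show False using kl_eq pos r by linarith
      qed
      ultimately show ?thesis by blast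
    next
      case nocover: False
      \<comment> \<open>Write \<open>k * l + r = p + q\<close>. If \<open>p\<close> is at least
        \<open>k * l\<close>, then \<open>q < l\<close> forces \<open>q = 0\<close>. If both
        summands are below \<open>k * l\<close>, induction makes \<open>q\<close> a multiple of
        \<open>l\<close> and puts the whole block of \<open>p\<close> into \<open>A\<close>;
        comparing quotients by \<open>l\<close> then yields the excluded cover.\<close>
      have rep: "k * l + r \<in> A \<or> (\<exists>q\<in>B. k * l \<le> q \<and> q \<le> k * l + r)"
        if r: "0 \<le> r" "r < l" "k * l + r < n" for r
      proof -
        obtain p q where pq: "p \<in> A" "q \<in> B" "k * l + r = p + q"
          using represent[of "k * l + r"] r kl l(2) by fastforce
        have nn: "0 \<le> p" "0 \<le> q" using pq A_nonneg B_nonneg by auto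
        show ?thesis
        proof (cases "k * l \<le> p")
          case True
          then have "q < l" using pq r by linarith
          then have "q = 0" using q0 pq by blast
          then show ?thesis using pq by simp
        next
          case p_small: False
          show ?thesis
          proof (cases "k * l \<le> q")
            case True
            then show ?thesis using pq nn by auto
          next
            case False
            have ltk: "z div l < k" if "z < k * l" for z
            proof -
              have "z div l * l \<le> z"
                using l(2) by (simp flip: minus_mod_eq_div_mult)
              then show ?thesis using that l(2) by (meson mult_less_cancel_right_pos order.strict_trans1)
            qed
            have pd: "p div l * l + p mod l = p" "q div l * l + q mod l = q" by simp_all
            have md: "0 \<le> p mod l" "p mod l < l" "0 \<le> q mod l" "q mod l < l"
              using l(2) by simp_all
            have dv: "0 \<le> p div l" "0 \<le> q div l" "p div l < k" "q div l < k"
              using nn l(2) p_small False ltk by (auto simp: pos_imp_zdiv_nonneg_iff)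
            have q_mod: "q mod l = 0"
              using IH_B[OF dv(2,4), of "q mod l"] pd md pq by simp
            have pA: "p div l * l + r' \<in> A" if "0 \<le> r'" "r' < l" for r'
              using IH_A[OF dv(1,3), of "p mod l" r'] pd md pq that by simp
            have qB: "q div l * l \<in> B" using q_mod pd pq by simp
            have "k * l + r = (p div l + q div l) * l + p mod l"
              using pq(3) pd q_mod by (simp add: distrib_right)
            then have "(k * l + r) div l = ((p div l + q div l) * l + p mod l) div l"
              by simp
            then have "p div l + q div l = k"
              using r md l(2) by simp
            then show ?thesis using nocover dv pA qB by blast
          qed
        qed
      qed
      \<comment> \<open>A nonzero offset produces a double representation. If \<open>k * l\<close>
        is in \<open>A\<close>, then \<open>k * l + l = (l - r) + (k * l + r)\<close>; if it is in
        \<open>B\<close>, then \<open>r + k * l = 0 + (k * l + r)\<close>.\<close>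
      have B_block: "r = 0" if r: "0 \<le> r" "r < l" and rB: "k * l + r \<in> B" for r
      proof (rule ccontr)
        assume "r \<noteq> 0"
        with r have r0: "0 < r" by simp
        have "k * l + r < n" using sum_less[OF zero_in_A rB] by simp
        then consider "k * l \<in> A" | "k * l \<in> B"
          using rep[of 0] r0 l(2) by force
        then show False
        proof cases
          case 1
          have "l - r \<in> A" using init r r0 by simp
          from unique[OF 1 l(1) this rB] show False using r0 kl by simp
        next
          case 2
          from unique[OF init[OF r] 2 zero_in_A rB] show False using r0 by simp
        qed
      qed
      moreover have "k * l + r' \<in> A"
        if r: "0 \<le> r" "r < l" "0 \<le> r'" "r' < l" and rA: "k * l + r \<in> A" for r r'
      proof -
        \<comment> \<open>An element of \<open>A\<close> in the block excludes \<open>k * l\<close>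
          from \<open>B\<close>, so \<open>B\<close> misses the block and \<open>rep\<close> puts
          every block element below \<open>n\<close> into \<open>A\<close>.\<close>
        have nB: "k * l \<notin> B"
        proof
          assume "k * l \<in> B"
          from unique[OF init[OF r(1,2)] this rA zero_in_B] show False using kl l(2) by simp
        qed
        have disj: "q \<notin> B" if "k * l \<le> q" "q < k * l + l" for q
          using B_block[of "q - k * l"] nB that by auto
        have "k * l < n" using sum_less[OF rA zero_in_B] r by simp
        then have "k * l \<in> A" using rep[of 0] disj l(2) by auto
        \<comment> \<open>The sum of \<open>k * l\<close> in \<open>A\<close> and \<open>l\<close>
          in \<open>B\<close> stays below \<open>n\<close>, so the block is not cut off by the end
          of the interval.\<close>
        then have "k * l + l < n" using sum_less l(1) by blast
        then show ?thesis using rep[of r'] disj r by force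
      qed
      ultimately show ?thesis by blast
    qed
  qed
qed

lemma A_eq_if_B_trivial:
  assumes "B \<subseteq> {0}"
  shows "A = {0..n - 1}"
proof -
  have "z \<in> A" if "0 \<le> z" "z < n" for z
    using represent[OF that] assms by auto
  moreover have "z < n" if "z \<in> A" for z
    using sum_less[OF that zero_in_B] by simp
  ultimately show ?thesis using A_nonneg by force
qed

text \<open>Prepares the transfer to labels: here \<open>k\<close> ranges over all integers, so that
  blocks can be reflected without sign conditions.\<close>

lemma block_structure:
  obtains l where "2 \<le> l" "\<And>q. q \<in> B \<Longrightarrow> l dvd q"
    "\<And>k r r'. \<lbrakk>0 \<le> r; r < l; 0 \<le> r'; r' < l; k * l + r \<in> A\<rbrakk> \<Longrightarrow> k * l + r' \<in> A"
proof (cases "B \<subseteq> {0}")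
  case True
  have n2: "2 \<le> n" using sum_less[OF one_in_A zero_in_B] by simp
  have "k * n + r' \<in> A" if "0 \<le> r" "r < n" "0 \<le> r'" "r' < n" "k * n + r \<in> A" for k r r'
  proof -
    \<comment> \<open>With \<open>l = n\<close>, the set \<open>A\<close> is exactly block
      0.\<close>
    have "(k * n + r) div n = 0" using that A_eq_if_B_trivial[OF True] by simp
    then have "k = 0" using that(1,2) by simp
    then show ?thesis using that A_eq_if_B_trivial[OF True] by simp
  qed
  moreover have "n dvd q" if "q \<in> B" for q using that True by auto
  ultimately show ?thesis using that[OF n2] by blast
next
  case False
  \<comment> \<open>The minimum is taken over \<open>nat\<close>, whose well-ordering guarantees
    that \<open>LEAST\<close> is attained.\<close>
  define m where "m = (LEAST m. int m \<in> B \<and> 0 < m)"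
  obtain q where "q \<in> B" "q \<noteq> 0" using False by blast
  then have "q \<in> B" "0 < q" using B_nonneg[of q] by simp_all
  then have "int (nat q) \<in> B \<and> 0 < nat q" by simp
  then have m: "int m \<in> B" "0 < m" unfolding m_def by (rule LeastI2, simp)+
  have least: "int m \<le> q" if "q \<in> B" "0 < q" for q
    using Least_le[of "\<lambda>m. int m \<in> B \<and> 0 < m" "nat q"] that unfolding m_def by simp
  note blk = blocks[OF m(1) _ least, simplified, OF m(2)]
  \<comment> \<open>Otherwise 1 would be both \<open>1 + 0\<close> and \<open>0 + 1\<close>; in this
    case the normalization \<open>1 \<in> A\<close> thus gives \<open>l \<ge> 2\<close>.\<close>
  have "m \<noteq> 1" using unique[OF one_in_A zero_in_B zero_in_A m(1)] by auto
  then have m2: "2 \<le> int m" using m by simp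
  have "int m dvd q" if "q \<in> B" for q
  proof -
    have "q mod int m = 0"
      using blk[of "q div int m"] that B_nonneg[OF that] m
      by (simp add: pos_imp_zdiv_nonneg_iff)
    then show ?thesis by auto
  qed
  moreover have "k * int m + r' \<in> A"
    if "0 \<le> r" "r < int m" "0 \<le> r'" "r' < int m" "k * int m + r \<in> A" for k r r'
  proof -
    \<comment> \<open>\<open>blocks\<close> treats nonnegative \<open>k\<close> only; a negative
      \<open>k\<close> would put a negative element into \<open>A\<close>.\<close>
    have "0 \<le> (k * int m + r) div int m"
      using A_nonneg[OF that(5)] m(2) by (subst pos_imp_zdiv_nonneg_iff) simp_all
    then have "0 \<le> k" using that m by simp
    then show ?thesis using blk that by blast
  qed
  ultimately show ?thesis using that[of "int m"] m2 by blast
qed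

end

section \<open>Labels and label differences of a complete bipartite graph\<close>

text \<open>The label of \<open>Inl 0\<close> decides everything: the edges at \<open>Inl 0\<close>
  fix the side of all right vertices, and the edges at \<open>Inr 0\<close> then fix the side of all
  left vertices.\<close>

lemma complete_bipartite_labels:
  fixes a b :: nat and f :: "nat + nat \<Rightarrow> int"
  defines "G \<equiv> complete_bipartite a b"
  assumes ab: "0 < a * b"
    and sep: "separates G f x"
  shows "(small_labels G f x = f ` Inl ` {..<a} \<and> large_labels G f x = f ` Inr ` {..<b}) \<or>
         (small_labels G f x = f ` Inr ` {..<b} \<and> large_labels G f x = f ` Inl ` {..<a})"
proof -
  have edge: "(f (Inl i) \<le> x \<and> x < f (Inr j)) \<or> (f (Inr j) \<le> x \<and> x < f (Inl i))"
    if "i < a" "j < b" for i j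
  proof -
    have "{Inl i, Inr j} \<in> edges G" using that by (auto simp: G_def complete_bipartite_def)
    then obtain u v where "{Inl i, Inr j} = {u, v}" "f u \<le> x" "x < f v"
      using sep unfolding separates_def by metis
    then show ?thesis by (auto simp: doubleton_eq_iff)
  qed
  have V: "f ` verts G = f ` Inl ` {..<a} \<union> f ` Inr ` {..<b}"
    by (auto simp: G_def complete_bipartite_def Plus_def)
  have a0: "0 < a" and b0: "0 < b" using ab by auto
  show ?thesis
  proof (cases "f (Inl 0) \<le> x")
    case True
    then have r: "x < f (Inr j)" if "j < b" for j using edge[OF a0 that] by auto
    have l: "f (Inl i) \<le> x" if "i < a" for i using edge[OF that b0] r[OF b0] by auto
    show ?thesis unfolding small_labels_def large_labels_def V using l r by force
  next
    case False
    then have r: "f (Inr j) \<le> x" if "j < b" for j using edge[OF a0 that] by auto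
    have l: "x < f (Inl i)" if "i < a" for i using edge[OF that b0] r[OF b0] by auto
    show ?thesis unfolding small_labels_def large_labels_def V using l r by force
  qed
qed

text \<open>The valuation property only says that every difference occurs. Injectivity follows by
  counting, since there are as many pairs as differences, namely \<open>a * b\<close>; it becomes
  the uniqueness of representations.\<close>

lemma complete_bipartite_differences:
  fixes a b :: nat and f :: "nat + nat \<Rightarrow> int"
  defines "G \<equiv> complete_bipartite a b"
  defines "S x \<equiv> small_labels G f x" and "L x \<equiv> large_labels G f x"
  assumes ab: "0 < a * b" and f: "alpha_valuation G f" and sep: "separates G f x"
  shows "bij_betw (\<lambda>(y, s). y - s) (L x \<times> S x) {1..int (a * b)}"
proof -
  have n: "card (edges G) = a * b" unfolding G_def by (rule card_edges_complete_bipartite)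
  have inj: "inj_on f (Inl ` {..<a} \<union> Inr ` {..<b})"
    using f by (auto simp: alpha_valuation_def G_def complete_bipartite_def Plus_def)
  then have injl: "inj_on f (Inl ` {..<a})" and injr: "inj_on f (Inr ` {..<b})"
    by (auto intro: inj_on_subset)
  have cards: "card (f ` Inl ` {..<a}) = a" "card (f ` Inr ` {..<b}) = b"
    using injl injr by (simp_all add: card_image)
  note labels = complete_bipartite_labels[OF ab sep[unfolded G_def], folded G_def,
      folded S_def L_def]
  have fin: "finite (L x \<times> S x)" using labels by auto
  have card: "card (L x \<times> S x) = a * b"
    using labels cards by (auto simp: card_cartesian_product)
  have diffs: "{\<bar>f u - f v\<bar> | u v. {u, v} \<in> edges G} = {1..int (a * b)}"
    using f n by (simp add: alpha_valuation_def)
  have SL: "s \<le> x" "x < y" if "s \<in> S x" "y \<in> L x" for s y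
    using that by (auto simp: S_def L_def small_labels_def large_labels_def)
  have "(\<lambda>(y, s). y - s) ` (L x \<times> S x) = {\<bar>f u - f v\<bar> | u v. {u, v} \<in> edges G}"
  proof (intro equalityI subsetI)
    fix d assume "d \<in> (\<lambda>(y, s). y - s) ` (L x \<times> S x)"
    then obtain y s where ys: "y \<in> L x" "s \<in> S x" "d = y - s" by auto
    then have d: "d = \<bar>y - s\<bar>" using SL[OF ys(2,1)] by simp
    have edge: "{Inl i, Inr j} \<in> edges G" "{Inr j, Inl i} \<in> edges G" if "i < a" "j < b" for i j
      using that by (auto simp: G_def complete_bipartite_def)
    have "\<exists>u v. {u, v} \<in> edges G \<and> y = f u \<and> s = f v"
      using labels
    proof (elim disjE conjE)
      assume "S x = f ` Inl ` {..<a}" "L x = f ` Inr ` {..<b}"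
      then obtain i j where "i < a" "j < b" "s = f (Inl i)" "y = f (Inr j)" using ys by auto
      then show ?thesis using edge by blast
    next
      assume "S x = f ` Inr ` {..<b}" "L x = f ` Inl ` {..<a}"
      then obtain i j where "i < a" "j < b" "s = f (Inr j)" "y = f (Inl i)" using ys by auto
      then show ?thesis using edge by blast
    qed
    then show "d \<in> {\<bar>f u - f v\<bar> | u v. {u, v} \<in> edges G}" using d by blast
  next
    fix d assume "d \<in> {\<bar>f u - f v\<bar> | u v. {u, v} \<in> edges G}"
    then obtain u v where uv: "{u, v} \<in> edges G" "d = \<bar>f u - f v\<bar>" by blast
    obtain u' v' where uv': "{u, v} = {u', v'}" "f u' \<le> x" "x < f v'"
      using sep uv(1) unfolding separates_def by metis
    have "u' \<in> verts G" "v' \<in> verts G"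
      using uv(1) unfolding uv'(1) G_def complete_bipartite_def
      by (auto simp: doubleton_eq_iff)
    then have "f u' \<in> S x" "f v' \<in> L x"
      using uv' by (auto simp: S_def L_def small_labels_def large_labels_def)
    moreover have "d = f v' - f u'" using uv uv' by (auto simp: doubleton_eq_iff)
    ultimately show "d \<in> (\<lambda>(y, s). y - s) ` (L x \<times> S x)" by force
  qed
  then have img: "(\<lambda>(y, s). y - s) ` (L x \<times> S x) = {1..int (a * b)}" using diffs by simp
  then have "inj_on (\<lambda>(y, s). y - s) (L x \<times> S x)"
    using card fin by (intro eq_card_imp_inj_on) (simp_all del: of_nat_mult)
  then show ?thesis using img by (simp add: bij_betw_def)
qed

section \<open>Transfer of the block structure to the labels\<close>

text \<open>The hypothesis \<open>near\<close> is the normalization \<open>1 \<in> A\<close> in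
  terms of labels.\<close>

lemma complete_bipartite_runs:
  fixes a b :: nat and f :: "nat + nat \<Rightarrow> int"
  defines "G \<equiv> complete_bipartite a b"
  assumes ab: "1 < a * b" and f: "alpha_valuation G f" and sep: "separates G f x"
    and near: "x - 1 \<in> small_labels G f x"
  shows "\<exists>l\<ge>2. (\<forall>z\<in>large_labels G f x. l dvd z) \<and>
           (\<exists>I. small_labels G f x = (\<Union>i\<in>I. {i * l..i * l + l - 1}))"
proof -
  define S where "S = small_labels G f x"
  define L where "L = large_labels G f x"
  have n: "card (edges G) = a * b" unfolding G_def by (rule card_edges_complete_bipartite)
  have bij: "bij_betw (\<lambda>(y, s). y - s) (L \<times> S) {1..int (a * b)}"
    unfolding S_def L_def G_def
    using ab f sep by (intro complete_bipartite_differences) (auto simp: G_def intro: Nat.gr0I)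
  have range: "f ` verts G \<subseteq> {0..int (a * b)}" using f n by (simp add: alpha_valuation_def)
  have S: "0 \<le> s \<and> s \<le> x" if "s \<in> S" for s
    using that range by (auto simp: S_def small_labels_def)
  have L: "x < y \<and> y \<le> int (a * b)" if "y \<in> L" for y
    using that range by (auto simp: L_def large_labels_def)
  have ex: "\<exists>y\<in>L. \<exists>s\<in>S. d = y - s" if "1 \<le> d" "d \<le> int (a * b)" for d
  proof -
    have "d \<in> (\<lambda>(y, s). y - s) ` (L \<times> S)" using that bij by (simp add: bij_betw_def)
    then show ?thesis by auto
  qed
  have diff: "y - s \<le> int (a * b)" if "y \<in> L" "s \<in> S" for y s using S L that by force
  have inj: "y = y' \<and> s = s'" if "y \<in> L" "s \<in> S" "y' \<in> L" "s' \<in> S" "y - s = y' - s'" for y s y' s'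
    using bij that unfolding bij_betw_def inj_on_def by auto
  have ab': "1 \<le> int (a * b)" using ab by linarith
  \<comment> \<open>The extreme differences pin down labels: difference 1 forces
    \<open>s = x\<close> and \<open>y = x + 1\<close>, and difference \<open>a * b\<close> forces
    \<open>s = 0\<close>.\<close>
  obtain y s where "y \<in> L" "s \<in> S" "1 = y - s" using ex[OF order_refl ab'] by blast
  then have xS: "x \<in> S" and xL: "x + 1 \<in> L" using S[of s] L[of y]
    by (smt (verit))+
  obtain y s where "y \<in> L" "s \<in> S" "int (a * b) = y - s" using ex[OF ab' order_refl] by blast
  then have zS: "0 \<in> S" using S[of s] L[of y] by (smt (verit))
  \<comment> \<open>For \<open>p = x - s\<close> and \<open>q = y - (x + 1)\<close> the sum is
    \<open>(y - s) - 1\<close>, so the differences \<open>{1..a * b}\<close> become the interval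
    starting at 0.\<close>
  interpret interval_factorization "{p. x - p \<in> S}" "{q. x + 1 + q \<in> L}" "int (a * b)"
  proof
    show "\<exists>p\<in>{p. x - p \<in> S}. \<exists>q\<in>{q. x + 1 + q \<in> L}. z = p + q" if z: "0 \<le> z" "z < int (a * b)" for z
    proof -
      obtain y s where ys: "y \<in> L" "s \<in> S" "z + 1 = y - s" using ex[of "z + 1"] z by force
      show ?thesis
        using ys by (intro bexI[of _ "x - s"] bexI[of _ "y - x - 1"]) auto
    qed
  next
    fix p q p' q' assume "p \<in> {p. x - p \<in> S}" "q \<in> {q. x + 1 + q \<in> L}"
      "p' \<in> {p. x - p \<in> S}" "q' \<in> {q. x + 1 + q \<in> L}" "p + q = p' + q'"
    then show "p = p' \<and> q = q'" using inj[of "x + 1 + q" "x - p" "x + 1 + q'" "x - p'"] by auto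
  next
    fix p q assume "p \<in> {p. x - p \<in> S}" "q \<in> {q. x + 1 + q \<in> L}"
    then show "p + q < int (a * b)" using diff[of "x + 1 + q" "x - p"] by simp
  qed (use S L xS xL near in \<open>force simp: S_def[symmetric]\<close>)+
  obtain l where l2: "2 \<le> l" and dvd: "\<And>q. x + 1 + q \<in> L \<Longrightarrow> l dvd q"
    and run: "\<And>k r r'. \<lbrakk>0 \<le> r; r < l; 0 \<le> r'; r' < l; x - (k * l + r) \<in> S\<rbrakk> \<Longrightarrow> x - (k * l + r') \<in> S"
    using block_structure by auto
  \<comment> \<open>The label 0 makes \<open>x\<close> an element of \<open>A\<close>, so the last
    element of the block of \<open>x\<close> is in \<open>A\<close> too. Elements of
    \<open>A\<close> do not exceed \<open>x\<close>, hence \<open>x\<close> is itself the last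
    one.\<close>
  have dvd_x: "l dvd x + 1"
  proof -
    have md: "0 \<le> x mod l" "x mod l < l" using l2 by simp_all
    have eq: "x = x div l * l + x mod l" by simp
    have "x - (x div l * l + x mod l) \<in> S" using zS by simp
    from run[OF md _ _ this, of "l - 1"] l2 have "x - (x div l * l + (l - 1)) \<in> S" by simp
    from S[OF this] md eq have "x mod l = l - 1" by linarith
    then have "x + 1 = (x div l + 1) * l" using eq unfolding distrib_right by linarith
    then show ?thesis by (metis dvd_triv_right)
  qed
  then obtain c where c: "x + 1 = c * l" by (metis dvd_def mult.commute)
  have "l dvd z" if "z \<in> L" for z
    using dvd_add[OF dvd[of "z - (x + 1)"] dvd_x] that by simp
  moreover have "S = (\<Union>i\<in>{i. i * l \<in> S}. {i * l..i * l + l - 1})"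
  proof -
    have run': "i * l + r' \<in> S"
      if "0 \<le> r" "r < l" "0 \<le> r'" "r' < l" "i * l + r \<in> S" for i r r'
    proof -
      \<comment> \<open>As \<open>x + 1 = c * l\<close>, the reflection at \<open>x\<close> carries
        block \<open>c - 1 - i\<close> onto block \<open>i\<close> and reverses the offsets.\<close>
      have eq: "x - ((c - 1 - i) * l + (l - 1 - t)) = i * l + t" for t
        using c by (simp add: algebra_simps)
      show ?thesis using run[of "l - 1 - r" "l - 1 - r'" "c - 1 - i"] that unfolding eq by simp
    qed
    show ?thesis
    proof (intro equalityI subsetI)
      fix s assume s: "s \<in> S"
      have md: "0 \<le> s mod l" "s mod l < l" using l2 by simp_all
      have eq: "s = s div l * l + s mod l" by simp
      have "s div l * l \<in> S" using run'[OF md, of 0 "s div l"] s l2 by simp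
      moreover have "s \<in> {s div l * l..s div l * l + l - 1}"
        unfolding atLeastAtMost_iff using md eq by linarith
      ultimately show "s \<in> (\<Union>i\<in>{i. i * l \<in> S}. {i * l..i * l + l - 1})" by blast
    next
      fix s assume "s \<in> (\<Union>i\<in>{i. i * l \<in> S}. {i * l..i * l + l - 1})"
      then obtain i where "i * l \<in> S" "i * l \<le> s" "s \<le> i * l + l - 1" by auto
      then show "s \<in> S" using run'[of 0 "s - i * l" i] l2 by simp
    qed
  qed
  ultimately show ?thesis using l2 unfolding S_def L_def by blast
qed

section \<open>Complementary valuations and the reduction to the normalized case\<close>

lemma Phi_alpha_valuation:
  assumes f: "alpha_valuation (complete_bipartite a b) f"
    and sep: "separates (complete_bipartite a b) f x" and ab: "0 < a * b"
  shows "separates (complete_bipartite a b) (\<lambda>v. Phi a b (f v)) (int (a * b) - x - 1)"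
    and "alpha_valuation (complete_bipartite a b) (\<lambda>v. Phi a b (f v))"
proof -
  let ?G = "complete_bipartite a b"
  note n = card_edges_complete_bipartite[of a b]
  have range: "f ` verts ?G \<subseteq> {0..int (a * b)}" using f n by (simp add: alpha_valuation_def)
  have edges: "\<exists>u v. e = {u, v} \<and> f u \<le> x \<and> x < f v" if "e \<in> edges ?G" for e
    using sep that by (auto simp: separates_def)
  have e0: "{Inl 0, Inr 0} \<in> edges ?G" using ab by (auto simp: complete_bipartite_def)
  \<comment> \<open>Needed for the new separating value \<open>a * b - x - 1\<close> to be
    nonnegative; the -1 appears because complementing turns the strict bound \<open>x < f v\<close>
    into a weak one.\<close>
  have "x < int (a * b)"
  proof -
    obtain u v where uv: "{Inl 0, Inr 0} = {u, v}" "x < f v" using edges[OF e0] by blast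
    then have "v \<in> verts ?G" using ab by (auto simp: complete_bipartite_def doubleton_eq_iff)
    then show ?thesis using uv range by force
  qed
  moreover have "\<exists>u v. e = {u, v} \<and> Phi a b (f u) \<le> int (a * b) - x - 1 \<and>
      int (a * b) - x - 1 < Phi a b (f v)" if e: "e \<in> edges ?G" for e
  proof -
    obtain u v where "e = {v, u}" "f u \<le> x" "x < f v"
      using edges[OF e] by (auto simp: insert_commute)
    then show ?thesis by (intro exI[of _ v] exI[of _ u]) (simp add: Phi_def)
  qed
  ultimately show sep': "separates ?G (\<lambda>v. Phi a b (f v)) (int (a * b) - x - 1)"
    using sep n by (simp add: separates_def)
  have "inj_on (\<lambda>v. Phi a b (f v)) (verts ?G)"
    using f by (auto simp: alpha_valuation_def inj_on_def Phi_def)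
  moreover have "(\<lambda>v. Phi a b (f v)) ` verts ?G \<subseteq> {0..int (a * b)}"
    using range by (auto simp: Phi_def)
  moreover have "\<bar>Phi a b (f u) - Phi a b (f v)\<bar> = \<bar>f u - f v\<bar>" for u v
    by (simp add: Phi_def)
  ultimately show "alpha_valuation ?G (\<lambda>v. Phi a b (f v))"
    using f sep' unfolding alpha_valuation_def n by auto
qed

theorem theorem2p1:
  fixes a b :: nat and f :: "nat + nat \<Rightarrow> int"
  assumes "a * b > 1"
    and "alpha_valuation (complete_bipartite a b) f"
  shows "\<exists>l\<ge>2. \<exists>g x. alpha_valuation (complete_bipartite a b) g \<and>
           valuation_equiv a b f g \<and>
           separates (complete_bipartite a b) g x \<and>
           (\<forall>z\<in>large_labels (complete_bipartite a b) g x. l dvd z) \<and>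
           (\<exists>I. small_labels (complete_bipartite a b) g x = (\<Union>i\<in>I. {i * l..i * l + l - 1}))"
proof -
  let ?G = "complete_bipartite a b"
  have ab: "0 < a * b" using assms(1) by linarith
  obtain x where x: "separates ?G f x" using assms(2) by (auto simp: alpha_valuation_def)
  \<comment> \<open>Since \<open>a * b > 1\<close>, the difference 2 occurs. It is realized across
    \<open>x\<close>, so either \<open>x - 1\<close> is a small label or \<open>x + 2\<close> is a
    large one: 1 lies in \<open>A\<close> or in \<open>B\<close>.\<close>
  have "(2::int) \<in> (\<lambda>(y, s). y - s) ` (large_labels ?G f x \<times> small_labels ?G f x)"
    using complete_bipartite_differences[OF ab assms(2) x] assms(1)
    by (simp add: bij_betw_def del: of_nat_mult)
  then obtain y s where ys: "y \<in> large_labels ?G f x" "s \<in> small_labels ?G f x" "2 = y - s"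
    by auto
  then have "x < y" "s \<le> x" by (auto simp: small_labels_def large_labels_def)
  with ys(3) consider "s = x - 1" | "y = x + 2" by linarith
  then show ?thesis
  proof cases
    case 1
    have "valuation_equiv a b f f" by (simp add: valuation_equiv_def)
    then show ?thesis
      using complete_bipartite_runs[OF assms x] ys(2) 1 assms(2) x by blast
  next
    case 2
    let ?g = "\<lambda>v. Phi a b (f v)" and ?x = "int (a * b) - x - 1"
    note g = Phi_alpha_valuation[OF assms(2) x ab]
    \<comment> \<open>Complementing sends the large label \<open>x + 2\<close> to
      \<open>a * b - x - 2\<close>, which is \<open>?x - 1\<close>.\<close>
    have "?x - 1 \<in> small_labels ?G ?g ?x"
    proof -
      obtain v where "v \<in> verts ?G" "f v = x + 2" using ys(1) 2 by (auto simp: large_labels_def)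
      moreover from this have "?x - 1 = ?g v" by (simp add: Phi_def)
      ultimately have "?x - 1 \<in> ?g ` verts ?G" by (metis image_eqI)
      then show ?thesis by (simp add: small_labels_def)
    qed
    moreover have "valuation_equiv a b f ?g" by (simp add: valuation_equiv_def)
    ultimately show ?thesis
      using complete_bipartite_runs[OF assms(1) g(2,1)] g by blast
  qed
qed

end
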